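(* If a piecewise affine Lebesgue measure-preserving continuous circle map $f:\mathbb{S}^1\to\mathbb{S}^1$ has different critical values and slope strictly greater than $4$, then $f$ is leo (locally eventually onto).
   Context: The circle $\mathbb{S}^1$ is identified with $[0,1)$ (i.e. $\mathbb{R}/\mathbb{Z}$); measure-preserving refers to normalized Lebesgue measure $\lambda$ on $\mathbb{S}^1$. A continuous circle map is piecewise affine if there is a finite partition of $\mathbb{S}^1$ into arcs such that the map is affine on each element of the partition. A critical point (turning point) of $f$ is a point $x$ such that $f(x)$ is a strict local extremum (in terms of a lifting of $f$ to $\mathbb{R}$); critical values are the images of critical points. "Different critical values" means that distinct critical points of $f$ have distinct images in $\mathbb{S}^1$. A piecewise monotone map $f$ has slope $>s$ if $\left|\frac{f(x)-f(y)}{x-y}\right|>s$ whenever $x\neq y$ are points of an arc of monotonicity of $f$ (differences being computed in a lifting of $f$ to $\mathbb{R}$). $f$ is leo if for every nonempty open set $U\subset\mathbb{S}^1$ there is $n\in\mathbb{N}$ such that $f^n(U)=\mathbb{S}^1$. *)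

theory Defs
  imports "HOL-Analysis.Analysis"
begin

text \<open>
  The circle \<open>\<real>/\<int>\<close> has carrier \<open>{0..<1}\<close>, with \<open>frac :: real \<Rightarrow> real\<close> as the projection.
  Its topology is the quotient topology, not the subspace topology of \<open>{0..<1}\<close>:
  points close to \<open>1\<close> are close to \<open>0\<close>.
\<close>

definition circle :: "real topology" where
  "circle = topology (\<lambda>U. U \<subseteq> {0..<1} \<and> open (frac -` U :: real set))"

lemma openin_circle: "openin circle U \<longleftrightarrow> U \<subseteq> {0..<1} \<and> open (frac -` U :: real set)"
proof -
  have "istopology (\<lambda>U. U \<subseteq> {0..<1} \<and> open (frac -` U :: real set))"
    unfolding istopology_def by (auto simp: vimage_Union)
  then show ?thesis
    by (simp add: circle_def topology_inverse')
qed

lemma topspace_circle [simp]: "topspace circle = {0..<1}"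
proof -
  have "frac -` {0..<1} = (UNIV :: real set)"
    by (auto simp: frac_lt_1)
  then have "openin circle {0..<1}"
    by (simp add: openin_circle)
  then show ?thesis
    by (auto simp: topspace_def openin_circle)
qed

lemma quotient_map_frac: "quotient_map euclideanreal circle frac"
proof -
  have "frac ` UNIV = {0..<1::real}"
    by (auto simp: frac_lt_1 image_iff) (metis frac_eq)
  then show ?thesis
    by (auto simp: quotient_map_def openin_circle vimage_def)
qed

definition circle_measure :: "real measure" where
  "circle_measure = restrict_space lborel {0..<1}"

definition lebesgue_preserving :: "(real \<Rightarrow> real) \<Rightarrow> bool" where
  "lebesgue_preserving f \<longleftrightarrow>
     f \<in> measurable circle_measure circle_measure \<and>
     (\<forall>A\<in>sets circle_measure.
        emeasure circle_measure (f -` A \<inter> {0..<1}) = emeasure circle_measure A)"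

definition lifting :: "(real \<Rightarrow> real) \<Rightarrow> (real \<Rightarrow> real) \<Rightarrow> bool" where
  "lifting f F \<longleftrightarrow> continuous_on UNIV F \<and> (\<forall>x. frac (F x) = f (frac x))"

text \<open>
  The interval \<open>J\<close> of the real line is a lift of the arc \<open>A\<close>. Arcs may be open, half-open or
  closed, and may reduce to a point; by injectivity \<open>J\<close> has length at most \<open>1\<close>.
\<close>

definition arc_lift :: "real set \<Rightarrow> real set \<Rightarrow> bool" where
  "arc_lift A J \<longleftrightarrow> is_interval J \<and> J \<noteq> {} \<and> inj_on frac J \<and> frac ` J = A"

text \<open>
  A continuous circle map has a lifting, unique up to an additive integer constant, so
  the choice of \<open>F\<close> is immaterial in the following definitions.
\<close>

definition piecewise_affine :: "(real \<Rightarrow> real) \<Rightarrow> bool" where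
  "piecewise_affine f \<longleftrightarrow>
     (\<exists>F P. lifting f F \<and> finite P \<and> partition_on {0..<1} P \<and>
        (\<forall>A\<in>P. \<exists>J. arc_lift A J \<and> (\<exists>a b. \<forall>x\<in>J. F x = a * x + b)))"

definition critical_points :: "(real \<Rightarrow> real) \<Rightarrow> real set" where
  "critical_points f =
     {x \<in> {0..<1}. \<exists>F. lifting f F \<and>
        ((\<forall>\<^sub>F y in at x. F y < F x) \<or> (\<forall>\<^sub>F y in at x. F y > F x))}"

definition different_critical_values :: "(real \<Rightarrow> real) \<Rightarrow> bool" where
  "different_critical_values f \<longleftrightarrow> inj_on f (critical_points f)"

definition slope_greater :: "(real \<Rightarrow> real) \<Rightarrow> real \<Rightarrow> bool" where
  "slope_greater f s \<longleftrightarrow>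
     (\<exists>F. lifting f F \<and>
        (\<forall>A J. arc_lift A J \<and> (mono_on J F \<or> antimono_on J F) \<longrightarrow>
           (\<forall>x\<in>J. \<forall>y\<in>J. x \<noteq> y \<longrightarrow> \<bar>(F x - F y) / (x - y)\<bar> > s)))"

definition leo :: "(real \<Rightarrow> real) \<Rightarrow> bool" where
  "leo f \<longleftrightarrow> (\<forall>U. openin circle U \<and> U \<noteq> {} \<longrightarrow> (\<exists>n. (f ^^ n) ` U = {0..<1}))"

end

theory Submission
  imports Defs
begin

text \<open>
  The images of an arc under the iterates of \<open>f\<close> are arcs, and measure preservation prevents
  them from getting shorter: an arc lies in the preimage of its image. Suppose that none of them
  ever covers the circle. Their lengths then increase to a limit \<open>L \<le> 1\<close>, and a subsequence of
  the arcs converges. The bound on the slope enters through one observation,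
  \<open>four_branches_insufficient\<close>: a branch of slope larger than \<open>4\<close> contributes less than a quarter
  of the measure of a preimage, so no set of positive measure has a preimage that is covered by
  four such branches.

  If \<open>L < 1\<close>, the limit is a proper arc \<open>[a,b]\<close> whose image \<open>[c,d]\<close> is not longer than itself
  (\<open>non_expanding_arc_impossible\<close>). By preservation of measure, almost all of the preimage of
  \<open>[c,d]\<close> lies in \<open>[a,b]\<close>. So points slightly above \<open>c\<close> have preimages only near the points of
  \<open>[a,b]\<close> at height \<open>c\<close>. These are the end points, which carry one branch inside \<open>[a,b]\<close> each,
  and interior minima. Interior minima are critical points with the same critical value, so
  there is at most one, and it carries two branches. Four branches do not suffice.

  If \<open>L = 1\<close>, the complements of the arcs shrink to a point, and the preimage of each complement
  lies in the previous one. Near the limit point there are only two affine branches, which is again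
  too few (\<open>almost_full_arc_covers\<close>).

  All computations take place on the real line, with a lifting \<open>F\<close> and with sets that are
  invariant under integer translations.
\<close>

section \<open>Periodic sets and the measure of the circle\<close>

definition periodic_set :: "real set \<Rightarrow> bool" where
  "periodic_set B \<longleftrightarrow> (\<forall>x (k::int). x + of_int k \<in> B \<longleftrightarrow> x \<in> B)"

definition saturation :: "real set \<Rightarrow> real set" where
  "saturation S = {x. \<exists>k::int. x + of_int k \<in> S}"

lemma frac_mem_periodic:
  assumes "periodic_set B"
  shows "frac x \<in> B \<longleftrightarrow> x \<in> B"
  using assms unfolding periodic_set_def
  by (metis frac_def add_diff_cancel diff_add_cancel)

lemma subset_saturation: "S \<subseteq> saturation S"
  unfolding saturation_def by (auto intro: exI[of _ 0])

lemma periodic_saturation: "periodic_set (saturation S)"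
proof -
  have "x + of_int k \<in> saturation S \<longleftrightarrow> x \<in> saturation S" for x and k :: int
  proof
    assume "x + of_int k \<in> saturation S"
    then obtain m :: int where "x + of_int k + of_int m \<in> S"
      by (auto simp: saturation_def)
    then show "x \<in> saturation S"
      unfolding saturation_def by (auto intro!: exI[of _ "k + m"] simp: add.assoc)
  next
    assume "x \<in> saturation S"
    then obtain m :: int where "x + of_int m \<in> S"
      by (auto simp: saturation_def)
    then show "x + of_int k \<in> saturation S"
      unfolding saturation_def by (auto intro!: exI[of _ "m - k"])
  qed
  then show ?thesis
    by (simp add: periodic_set_def)
qed

lemma borel_saturation:
  assumes "S \<in> sets borel"
  shows "saturation S \<in> sets borel"
proof -
  have "saturation S = (\<Union>k::int. (\<lambda>x. x + of_int k) -` S)"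
    by (auto simp: saturation_def)
  moreover have "(\<lambda>x. x + of_int k) -` S \<in> sets borel" for k :: int
    using measurable_sets_borel[OF _ assms, of "\<lambda>x. x + of_int k"] by simp
  ultimately show ?thesis
    by auto
qed

lemma saturation_Int_window:
  assumes "S \<subseteq> {t..<t + 1}"
  shows "saturation S \<inter> {t..<t + 1} = S"
proof -
  have "x \<in> S" if "x + of_int k \<in> S" "x \<in> {t..<t + 1}" for x and k :: int
  proof -
    have "x + of_int k \<in> {t..<t + 1}"
      using that assms by blast
    with that(2) have "\<bar>real_of_int k\<bar> < 1"
      by auto
    then have "k = 0"
      by linarith
    with that(1) show ?thesis
      by simp
  qed
  then show ?thesis
    using subset_saturation[of S] assms by (auto simp: saturation_def)
qed

lemma borel_vimage_continuous:
  fixes F :: "real \<Rightarrow> real"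
  assumes "continuous_on UNIV F" "B \<in> sets borel"
  shows "F -` B \<in> sets borel"
  using assms by (intro measurable_sets_borel[of F borel]) (auto intro: borel_measurable_continuous_onI)

lemma lmeasurable_bounded_borel:
  assumes "B \<in> sets borel"
  shows "B \<inter> {u..v::real} \<in> lmeasurable" "B \<inter> {u..<v} \<in> lmeasurable"
proof -
  have "bounded (B \<inter> {u..v})" "bounded (B \<inter> {u..<v})"
    by (auto intro: bounded_subset[of "{u..v}"])
  then show "B \<inter> {u..v::real} \<in> lmeasurable" "B \<inter> {u..<v} \<in> lmeasurable"
    using assms by (auto intro!: bounded_set_imp_lmeasurable)
qed

text \<open>
  Cutting a window of length one at the integer that it contains and translating the two
  pieces turns it into \<open>[0,1)\<close>. So an arc may be measured in whichever window suits it,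
  and wrapping around at \<open>0\<close> never has to be discussed again.
\<close>

lemma measure_periodic_window:
  assumes B: "B \<in> sets borel" "periodic_set B"
  shows "measure lebesgue (B \<inter> {t..<t + 1}) = measure lebesgue (B \<inter> {0..<1})"
proof -
  have shift: "measure lebesgue (B \<inter> {u + of_int k..<v + of_int k})
      = measure lebesgue (B \<inter> {u..<v})" for u v and k :: int
  proof -
    have "(+) (of_int k) ` (B \<inter> {u..<v}) = B \<inter> {u + of_int k..<v + of_int k}"
    proof (intro equalityI subsetI)
      fix y assume "y \<in> B \<inter> {u + of_int k..<v + of_int k}"
      then have "y - of_int k \<in> B \<inter> {u..<v}"
        using B(2)[unfolded periodic_set_def, rule_format, of "y - of_int k" k] by auto
      then show "y \<in> (+) (of_int k) ` (B \<inter> {u..<v})"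
        by (intro image_eqI[of _ _ "y - of_int k"]) auto
    qed (use B(2) in \<open>auto simp: periodic_set_def add.commute[of "of_int k"]\<close>)
    then show ?thesis
      by (metis measure_translation)
  qed
  have split: "measure lebesgue (B \<inter> {u..<w})
      = measure lebesgue (B \<inter> {u..<v}) + measure lebesgue (B \<inter> {v..<w})"
    if "u \<le> v" "v \<le> w" for u v w
  proof -
    have "B \<inter> {u..<w} = (B \<inter> {u..<v}) \<union> (B \<inter> {v..<w})"
      using that by auto
    moreover have "(B \<inter> {u..<v}) \<inter> (B \<inter> {v..<w}) = {}"
      by auto
    ultimately show ?thesis
      using lmeasurable_bounded_borel[OF B(1)] by (simp add: measure_Un2 Diff_triv Int_commute measure_Un3)
  qed
  define r where "r = frac t"
  have r: "0 \<le> r" "r \<le> 1"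
    by (auto simp: r_def frac_lt_1 less_imp_le)
  have t: "t = r + of_int \<lfloor>t\<rfloor>" "t + 1 = (r + 1) + of_int \<lfloor>t\<rfloor>"
    by (auto simp: r_def frac_def)
  have "measure lebesgue (B \<inter> {t..<t + 1}) = measure lebesgue (B \<inter> {r..<r + 1})"
    using shift[of r "\<lfloor>t\<rfloor>" "r + 1"] unfolding t[symmetric] .
  also have "\<dots> = measure lebesgue (B \<inter> {r..<1}) + measure lebesgue (B \<inter> {1..<r + 1})"
    using r by (intro split) auto
  also have "measure lebesgue (B \<inter> {1..<r + 1}) = measure lebesgue (B \<inter> {0..<r})"
    using shift[of 0 1 r] by simp
  also have "measure lebesgue (B \<inter> {r..<1}) + measure lebesgue (B \<inter> {0..<r})
      = measure lebesgue (B \<inter> {0..<1})"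
    using split[of 0 r 1] r by simp
  finally show ?thesis .
qed

lemma measure_saturation:
  assumes "S \<in> sets borel" "S \<subseteq> {t..<t + 1}"
  shows "measure lebesgue (saturation S \<inter> {u..<u + 1}) = measure lebesgue S"
  using measure_periodic_window[OF borel_saturation[OF assms(1)] periodic_saturation]
    saturation_Int_window[OF assms(2)] by metis

text \<open>
  The two windows are independent because a preimage is best located relative to the arc that is
  being mapped, whereas the set itself is measured near its image.
\<close>

lemma lifting_preserves_measure:
  assumes F: "lifting f F" and pres: "lebesgue_preserving f"
    and B: "B \<in> sets borel" "periodic_set B"
  shows "measure lebesgue (F -` B \<inter> {t..<t + 1}) = measure lebesgue (B \<inter> {u..<u + 1})"
proof -
  have fr: "frac (F x) = f (frac x)" for x
    using F by (simp add: lifting_def)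
  have "continuous_on UNIV F"
    using F by (simp add: lifting_def)
  then have FB: "F -` B \<in> sets borel"
    using B(1) by (rule borel_vimage_continuous)
  have per: "periodic_set (F -` B)"
    unfolding periodic_set_def using frac_mem_periodic[OF B(2)] fr
    by (metis frac_add_of_int_right vimage_eq)
  have pre: "F -` B \<inter> {0..<1} = f -` (B \<inter> {0..<1}) \<inter> {0..<1}"
  proof -
    have "F x \<in> B \<longleftrightarrow> f x \<in> B \<inter> {0..<1}" if "x \<in> {0..<1}" for x
      using fr[of x] frac_mem_periodic[OF B(2), of "F x"] that
      by (metis IntI IntD1 atLeastLessThan_iff frac_eq_id frac_ge_0 frac_lt_1)
    then show ?thesis
      by auto
  qed
  have "B \<inter> {0..<1} \<in> sets circle_measure"
    using B(1) by (auto simp: circle_measure_def sets_restrict_space)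
  then have "emeasure circle_measure (f -` (B \<inter> {0..<1}) \<inter> {0..<1})
      = emeasure circle_measure (B \<inter> {0..<1})"
    using pres unfolding lebesgue_preserving_def by blast
  then have "emeasure lborel (F -` B \<inter> {0..<1}) = emeasure lborel (B \<inter> {0..<1})"
    unfolding pre[symmetric] by (simp add: circle_measure_def emeasure_restrict_space)
  then have "measure lebesgue (F -` B \<inter> {0..<1}) = measure lebesgue (B \<inter> {0..<1})"
    using FB B(1) by (simp add: measure_def)
  then show ?thesis
    using measure_periodic_window[OF FB per] measure_periodic_window[OF B] by simp
qed

section \<open>Few steep branches cannot carry the whole preimage\<close>

text \<open>
  The window \<open>[w, w + 1)\<close> makes the projection to the circle injective on the image of \<open>J\<close>.
  A long steep interval could wrap around the circle many times and contain preimages of large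
  total measure.
\<close>

definition steep_on :: "(real \<Rightarrow> real) \<Rightarrow> real set \<Rightarrow> bool" where
  "steep_on F J \<longleftrightarrow>
     (\<exists>\<alpha> \<beta> w. 4 < \<bar>\<alpha>\<bar> \<and> (\<forall>x\<in>J. F x = \<alpha> * x + \<beta> \<and> F x \<in> {w..<w + 1}))"

lemma measure_steep_preimage:
  assumes "steep_on F {u..v}" and B: "B \<in> sets borel" "periodic_set B"
    and pos: "0 < measure lebesgue (B \<inter> {0..<1})"
    and cont: "continuous_on UNIV F"
  shows "measure lebesgue (F -` B \<inter> {u..v}) < measure lebesgue (B \<inter> {0..<1}) / 4"
proof -
  obtain \<alpha> \<beta> w where \<alpha>: "4 < \<bar>\<alpha>\<bar>"
    and aff: "\<And>x. x \<in> {u..v} \<Longrightarrow> F x = \<alpha> * x + \<beta>"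
    and win: "\<And>x. x \<in> {u..v} \<Longrightarrow> F x \<in> {w..<w + 1}"
    using assms(1) unfolding steep_on_def by blast
  let ?S = "F -` B \<inter> {u..v}" and ?T = "(\<lambda>x. \<alpha> *\<^sub>R x + \<beta>)"
  have FB: "F -` B \<in> sets borel"
    by (rule borel_vimage_continuous[OF cont B(1)])
  then have S: "?S \<in> lmeasurable"
    by (rule lmeasurable_bounded_borel)
  have "\<bar>\<alpha>\<bar> * measure lebesgue ?S = measure lebesgue (?T ` ?S)"
    using measure_lebesgue_affine[of \<alpha> \<beta> ?S] by simp
  also have "\<dots> \<le> measure lebesgue (B \<inter> {w..<w + 1})"
  proof (rule measure_mono_fmeasurable)
    show "?T ` ?S \<subseteq> B \<inter> {w..<w + 1}"
      using aff win by fastforce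
    have "?T ` ?S = (\<lambda>y. (y - \<beta>) / \<alpha>) -` ?S"
      using \<alpha> by (force simp: field_simps image_iff)
    then have "?T ` ?S \<in> sets borel"
      using FB by (auto intro!: measurable_sets_borel)
    then show "?T ` ?S \<in> sets lebesgue"
      by simp
  qed (rule lmeasurable_bounded_borel[OF B(1)])
  also have "\<dots> = measure lebesgue (B \<inter> {0..<1})"
    by (rule measure_periodic_window[OF B])
  finally have le: "\<bar>\<alpha>\<bar> * measure lebesgue ?S \<le> measure lebesgue (B \<inter> {0..<1})" .
  show ?thesis
  proof (cases "measure lebesgue ?S = 0")
    case True
    with pos show ?thesis
      by simp
  next
    case False
    then have "0 < measure lebesgue ?S"
      using measure_nonneg[of lebesgue ?S] by linarith
    then have "4 * measure lebesgue ?S < \<bar>\<alpha>\<bar> * measure lebesgue ?S"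
      using \<alpha> by simp
    with le show ?thesis
      by simp
  qed
qed

text \<open>
  A branch of slope \<open>\<alpha>\<close> contributes at most the
  proportion \<open>1 / \<bar>\<alpha>\<bar> < 1/4\<close> of the measure of \<open>B\<close>, so at least five branches are needed
  to make up a preimage of full measure.
\<close>

lemma four_branches_insufficient:
  assumes F: "lifting f F" and pres: "lebesgue_preserving f"
    and B: "B \<in> sets borel" "periodic_set B" "0 < measure lebesgue (B \<inter> {0..<1})"
    and I: "finite I" "card I \<le> 4" "\<And>u v. (u, v) \<in> I \<Longrightarrow> steep_on F {u..v}"
    and cover: "F -` B \<inter> {t..<t + 1} \<subseteq> (\<Union>(u, v)\<in>I. {u..v})"
  shows False
proof -
  let ?m = "measure lebesgue (B \<inter> {0..<1})" and ?S = "\<lambda>(u, v). F -` B \<inter> {u..v}"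
  have cont: "continuous_on UNIV F"
    using F by (simp add: lifting_def)
  then have FB: "F -` B \<in> sets borel"
    using B(1) by (rule borel_vimage_continuous)
  then have S: "?S i \<in> lmeasurable" for i
    by (auto split: prod.split intro: lmeasurable_bounded_borel)
  have m: "?m = measure lebesgue (F -` B \<inter> {t..<t + 1})"
    using lifting_preserves_measure[OF F pres B(1,2), of t 0] by simp
  also have "\<dots> \<le> measure lebesgue (\<Union>i\<in>I. ?S i)"
  proof (rule measure_mono_fmeasurable)
    show "F -` B \<inter> {t..<t + 1} \<subseteq> (\<Union>i\<in>I. ?S i)"
      using cover by fastforce
    show "(\<Union>i\<in>I. ?S i) \<in> lmeasurable"
      using I(1) S by (intro fmeasurable.finite_UN) blast+
  qed (use FB in simp)
  also have "\<dots> \<le> (\<Sum>i\<in>I. measure lebesgue (?S i))"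
    using S I(1) by (intro measure_UNION_le) (auto dest: fmeasurableD)
  finally have le: "?m \<le> (\<Sum>i\<in>I. measure lebesgue (?S i))" .
  with B(3) have "I \<noteq> {}"
    by auto
  then have "(\<Sum>i\<in>I. measure lebesgue (?S i)) < (\<Sum>i\<in>I. ?m / 4)"
    using I measure_steep_preimage[OF _ B cont] by (intro sum_strict_mono) auto
  also have "\<dots> \<le> ?m"
    using I(2) B(3) by (simp add: field_simps)
  finally show False
    using le by simp
qed

section \<open>Liftings and their one-sided affine germs\<close>

lemma integer_valued_continuous_constant:
  fixes h :: "real \<Rightarrow> real"
  assumes "continuous_on UNIV h" "\<And>x. h x \<in> \<int>"
  shows "\<exists>k::int. \<forall>x. h x = of_int k"
proof -
  have "h constant_on UNIV"
  proof (rule continuous_discrete_range_constant[OF _ assms(1)])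
    show "\<exists>e>0. \<forall>y. y \<in> UNIV \<and> h y \<noteq> h x \<longrightarrow> e \<le> norm (h y - h x)" for x
    proof (intro exI[of _ 1] conjI allI impI)
      fix y assume "y \<in> UNIV \<and> h y \<noteq> h x"
      then show "1 \<le> norm (h y - h x)"
        using Ints_nonzero_abs_ge1[of "h y - h x"] assms(2) by auto
    qed simp
  qed simp
  then show ?thesis
    using assms(2) by (metis Ints_cases UNIV_I constant_on_def)
qed

lemma lifting_unique:
  assumes "lifting f F" "lifting f G"
  shows "\<exists>k::int. \<forall>x. G x = F x + of_int k"
proof -
  have "G x - F x \<in> \<int>" for x
    using assms unfolding lifting_def by (metis frac_eqE add_diff_cancel_left' Ints_of_int add.commute)
  moreover have "continuous_on UNIV (\<lambda>x. G x - F x)"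
    using assms by (auto simp: lifting_def intro!: continuous_intros)
  ultimately obtain k :: int where "\<forall>x. G x - F x = of_int k"
    using integer_valued_continuous_constant[of "\<lambda>x. G x - F x"] by blast
  then show ?thesis
    by (auto simp: algebra_simps intro!: exI[of _ k])
qed

lemma lifting_translate:
  assumes "lifting f F"
  shows "lifting f (\<lambda>x. F (x + of_int m))"
  using assms unfolding lifting_def
  by (auto intro!: continuous_on_compose2[of UNIV F] continuous_intros)

lemma lifting_integer_shift:
  assumes "lifting f F"
  shows "\<exists>k::int. \<forall>x. F (x + of_int m) = F x + of_int k"
  using lifting_unique[OF assms lifting_translate[OF assms]] .

lemma inj_on_frac_Icc:
  assumes "v < u + 1"
  shows "inj_on frac {u..v::real}"
  using bij_betw_imp_inj_on[OF bij_betw_frac[of u]] by (rule inj_on_subset) (use assms in auto)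

lemma arc_lift_dist_less_1:
  assumes "arc_lift A J" "x \<in> J" "y \<in> J"
  shows "\<bar>x - y\<bar> < 1"
proof (rule ccontr)
  have *: False if "u \<in> J" "v \<in> J" "u + 1 \<le> v" for u v
  proof -
    have "u + 1 \<in> J"
      using assms(1) that mem_is_interval_1_I[of J u v "u + 1"] by (simp add: arc_lift_def)
    moreover have "inj_on frac J"
      using assms(1) by (simp add: arc_lift_def)
    ultimately show False
      using that(1) inj_onD[of frac J u "u + 1"] by (simp add: frac_1_eq)
  qed
  assume "\<not> \<bar>x - y\<bar> < 1"
  then show False
    using *[OF assms(2,3)] *[OF assms(3,2)] by linarith
qed

text \<open>
  Finitely many integer translates of lifted arcs of the partition cover a neighbourhood of
  \<open>x\<close>, so one of them contains points of \<open>S\<close> arbitrarily close to \<open>x\<close>; being an interval, its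
  closure reaches from \<open>x\<close> to a point of \<open>S\<close>. Taking for \<open>S\<close> one side of \<open>x\<close> gives the affine
  germ of the lifting on that side.
\<close>

lemma affine_towards:
  assumes F: "lifting f F" and pa: "piecewise_affine f" and lim: "x islimpt S"
  obtains y a b where "y \<in> S" "y \<noteq> x" "\<forall>z\<in>closed_segment x y. F z = a * z + b"
proof -
  obtain F0 P where F0: "lifting f F0" and P: "finite P" "partition_on {0..<1} P"
    and aff0: "\<forall>A\<in>P. \<exists>J. arc_lift A J \<and> (\<exists>a b. \<forall>x\<in>J. F0 x = a * x + b)"
    using pa unfolding piecewise_affine_def by blast
  from aff0 obtain J where J: "\<And>A. A \<in> P \<Longrightarrow> arc_lift A (J A)"
    and affJ: "\<And>A. A \<in> P \<Longrightarrow> \<exists>a b. \<forall>x\<in>J A. F0 x = a * x + b"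
    by metis
  have "\<And>A. A \<in> P \<Longrightarrow> \<exists>z. z \<in> J A"
    using J by (auto simp: arc_lift_def)
  then obtain z where z: "\<And>A. A \<in> P \<Longrightarrow> z A \<in> J A"
    by metis
  define I where "I = (SIGMA A:P. {m::int. \<bar>x + of_int m - z A\<bar> \<le> 2})"
  have "finite {m::int. \<bar>x + of_int m - c\<bar> \<le> 2}" for c
  proof (rule finite_subset)
    show "{m::int. \<bar>x + of_int m - c\<bar> \<le> 2} \<subseteq> {\<lfloor>c - x - 2\<rfloor>..\<lceil>c - x + 2\<rceil>}"
      by auto linarith+
  qed simp
  then have "finite I"
    using P(1) by (auto simp: I_def)
  have "\<exists>i\<in>I. y + of_int (snd i) \<in> J (fst i)" if "dist y x < 1" for y
  proof -
    have "frac y \<in> \<Union> P"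
      using partition_onD1[OF P(2)] frac_lt_1[of y] by auto
    then obtain A where A: "A \<in> P" "frac y \<in> A"
      by blast
    then have "frac y \<in> frac ` J A"
      using J by (auto simp: arc_lift_def)
    then obtain j where j: "j \<in> J A" "frac y = frac j"
      by blast
    then obtain m :: int where m: "j = y + of_int m"
      by (metis frac_eqE)
    have "\<bar>j - z A\<bar> < 1"
      using arc_lift_dist_less_1[OF J[OF A(1)] j(1) z[OF A(1)]] .
    then have "\<bar>x + of_int m - z A\<bar> \<le> 2"
      using that m by (auto simp: dist_real_def)
    then have "(A, m) \<in> I"
      using A(1) by (simp add: I_def)
    then show ?thesis
      using j(1) m by force
  qed
  then have "\<forall>\<^sub>F y in at x within S. \<exists>i\<in>I. y + of_int (snd i) \<in> J (fst i)"
    unfolding eventually_at by (intro exI[of _ 1]) auto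
  then have "\<exists>\<^sub>F y in at x within S. \<exists>i\<in>I. y + of_int (snd i) \<in> J (fst i)"
    using lim by (intro eventually_frequently) (auto simp: trivial_limit_within)
  then obtain i where i: "i \<in> I" and fr: "\<exists>\<^sub>F y in at x within S. y + of_int (snd i) \<in> J (fst i)"
    using \<open>finite I\<close> by (auto simp: frequently_bex_finite_distrib)
  obtain A m where Am: "i = (A, m)"
    by fastforce
  have A: "A \<in> P"
    using i Am by (simp add: I_def)
  define K where "K = {y. y + of_int m \<in> J A}"
  have frK: "\<exists>\<^sub>F y in at x within S. y \<in> K"
    using fr Am by (simp add: K_def)
  have near: "\<exists>y\<in>K. y \<in> S \<and> y \<noteq> x \<and> dist y x < e" if "0 < e" for e
  proof -
    have "\<forall>\<^sub>F y in at x within S. y \<in> S \<and> y \<noteq> x \<and> dist y x < e"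
      using that unfolding eventually_at by (intro exI[of _ e]) auto
    from frequently_eventually_frequently[OF frK this] show ?thesis
      using frequently_ex by fastforce
  qed
  have "x \<in> closure K"
    unfolding closure_approachable using near by blast
  have "is_interval K"
    unfolding is_interval_1
  proof (intro ballI allI impI)
    fix u v y assume "u \<in> K" "v \<in> K" "u \<le> y \<and> y \<le> v"
    then show "y \<in> K"
      using J[OF A] mem_is_interval_1_I[of "J A" "u + of_int m" "v + of_int m" "y + of_int m"]
      by (simp add: K_def arc_lift_def)
  qed
  obtain k0 :: int where k0: "\<forall>y. F y = F0 y + of_int k0"
    using lifting_unique[OF F0 F] by blast
  obtain k1 :: int where k1: "\<forall>y. F0 (y + of_int m) = F0 y + of_int k1"
    using lifting_integer_shift[OF F0] by blast
  obtain a b where ab: "\<forall>y\<in>J A. F0 y = a * y + b"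
    using affJ[OF A] by blast
  define b' where "b' = a * of_int m + b - of_int k1 + of_int k0"
  have affK: "F y = a * y + b'" if "y \<in> K" for y
  proof -
    have "F0 y + of_int k1 = a * (y + of_int m) + b"
      using that ab k1 unfolding K_def by (metis mem_Collect_eq)
    then show ?thesis
      using k0 by (simp add: b'_def algebra_simps)
  qed
  have "closed {y. F y = a * y + b'}"
    using F by (intro closed_Collect_eq) (auto simp: lifting_def intro!: continuous_intros)
  then have cl: "closure K \<subseteq> {y. F y = a * y + b'}"
    using affK by (intro closure_minimal) auto
  obtain y where y: "y \<in> K" "y \<in> S" "y \<noteq> x"
    using near[of 1] by auto
  have "convex (closure K)"
    using \<open>is_interval K\<close> by (simp add: convex_closure is_interval_convex_1)
  then have "closed_segment x y \<subseteq> closure K"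
    using \<open>x \<in> closure K\<close> y(1) closure_subset by (intro closed_segment_subset) auto
  then show ?thesis
    using cl y that[of y a b'] by blast
qed

lemma slope_of_affine_arc:
  assumes F: "lifting f F" and sl: "slope_greater f s"
    and uv: "u < v" "v < u + 1" and aff: "\<forall>x\<in>{u..v}. F x = a * x + b"
  shows "s < \<bar>a\<bar>"
proof -
  obtain G where G: "lifting f G"
    and slope: "\<And>A J x y. arc_lift A J \<Longrightarrow> mono_on J G \<or> antimono_on J G \<Longrightarrow>
      x \<in> J \<Longrightarrow> y \<in> J \<Longrightarrow> x \<noteq> y \<Longrightarrow> s < \<bar>(G x - G y) / (x - y)\<bar>"
    using sl unfolding slope_greater_def by blast
  obtain k :: int where k: "\<forall>x. G x = F x + of_int k"
    using lifting_unique[OF F G] by blast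
  have "arc_lift (frac ` {u..v}) {u..v}"
    using uv inj_on_frac_Icc by (auto simp: arc_lift_def is_interval_cc)
  moreover have "mono_on {u..v} G \<or> antimono_on {u..v} G"
  proof (cases "0 \<le> a")
    case True
    then have "mono_on {u..v} G"
      using aff k by (auto intro!: mono_onI mult_left_mono)
    then show ?thesis ..
  next
    case False
    then have "antimono_on {u..v} G"
      using aff k by (auto intro!: monotone_onI mult_left_mono_neg)
    then show ?thesis ..
  qed
  ultimately have "s < \<bar>(G u - G v) / (u - v)\<bar>"
    using uv by (intro slope) auto
  also have "(G u - G v) / (u - v) = a"
  proof -
    have "F u = a * u + b" "F v = a * v + b"
      using aff uv by auto
    then have "G u - G v = a * (u - v)"
      using k by (simp add: algebra_simps)
    then show ?thesis
      using uv by simp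
  qed
  finally show ?thesis .
qed

lemma steep_on_subset: "steep_on F J \<Longrightarrow> K \<subseteq> J \<Longrightarrow> steep_on F K"
  unfolding steep_on_def by (meson subsetD)

lemma steep_near:
  assumes F: "lifting f F" and pa: "piecewise_affine f" and sl: "slope_greater f 4"
  shows "\<exists>\<eta>>0. steep_on F {x - \<eta>..x} \<and> steep_on F {x..x + \<eta>}"
proof -
  have "continuous_on UNIV F"
    using F by (simp add: lifting_def)
  then have "isCont F x"
    by (simp add: continuous_on_eq_continuous_at)
  then obtain \<delta> where \<delta>: "0 < \<delta>" "\<And>y. dist y x < \<delta> \<Longrightarrow> dist (F y) (F x) < 1/2"
    unfolding continuous_at_eps_delta by (metis half_gt_zero zero_less_one)
  have steep: "steep_on F {u..v}"
    if uv: "u < v" "v < u + 1" and aff: "\<forall>y\<in>{u..v}. F y = a * y + b"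
      and close: "\<forall>y\<in>{u..v}. dist y x < \<delta>" for u v a b
  proof -
    have "4 < \<bar>a\<bar>"
      using slope_of_affine_arc[OF F sl uv aff] .
    moreover have "F y \<in> {F x - 1/2..<F x - 1/2 + 1}" if "y \<in> {u..v}" for y
    proof -
      have "\<bar>F y - F x\<bar> < 1/2"
        using \<delta>(2) close that by (metis dist_real_def)
      then show ?thesis
        unfolding atLeastLessThan_iff by linarith
    qed
    ultimately show ?thesis
      unfolding steep_on_def using aff by blast
  qed
  have "x islimpt {x<..}" "x islimpt {..<x}"
    by (rule islimpt_subset[OF islimpt_greaterThanLessThan1[of x "x + 1"]]
          islimpt_subset[OF islimpt_greaterThanLessThan2[of "x - 1" x]]; auto)+
  then obtain r a b l a' b' where r: "x < r" "\<forall>z\<in>closed_segment x r. F z = a * z + b"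
    and l: "l < x" "\<forall>z\<in>closed_segment x l. F z = a' * z + b'"
    by (metis affine_towards[OF F pa] greaterThan_iff lessThan_iff)
  define \<eta> where "\<eta> = min (min (r - x) (x - l)) (min (\<delta> / 2) (1 / 2))"
  have \<eta>: "0 < \<eta>" "\<eta> \<le> r - x" "\<eta> \<le> x - l" "\<eta> \<le> \<delta> / 2" "\<eta> \<le> 1/2"
    using r(1) l(1) \<delta>(1) unfolding \<eta>_def by linarith+
  have "steep_on F {x..x + \<eta>}"
  proof (rule steep)
    show "\<forall>y\<in>{x..x + \<eta>}. F y = a * y + b"
      using r \<eta> by (auto simp: closed_segment_eq_real_ivl)
  qed (use \<eta> \<delta>(1) in \<open>auto simp: dist_real_def\<close>)
  moreover have "steep_on F {x - \<eta>..x}"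
  proof (rule steep)
    show "\<forall>y\<in>{x - \<eta>..x}. F y = a' * y + b'"
      using l \<eta> by (auto simp: closed_segment_eq_real_ivl)
  qed (use \<eta> \<delta>(1) in \<open>auto simp: dist_real_def\<close>)
  ultimately show ?thesis
    using \<eta>(1) by blast
qed

text \<open>
  Affine germs with nonzero slope are injective on each side of \<open>p\<close>, which turns a weak
  minimum into a strict one. It is transported to the fundamental domain \<open>[0,1)\<close> by a
  translated lifting.
\<close>

lemma interior_minimum_is_critical:
  assumes F: "lifting f F" and pa: "piecewise_affine f" and sl: "slope_greater f 4"
    and p: "a < p" "p < b" and min: "\<And>y. y \<in> {a..b} \<Longrightarrow> F p \<le> F y"
  shows "frac p \<in> critical_points f"
proof -
  obtain \<eta> where \<eta>: "0 < \<eta>" "steep_on F {p - \<eta>..p}" "steep_on F {p..p + \<eta>}"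
    using steep_near[OF F pa sl] by blast
  have ne: "F y \<noteq> F p" if yp: "y \<noteq> p" "\<bar>y - p\<bar> \<le> \<eta>" for y
  proof -
    obtain J where J: "steep_on F J" "y \<in> J" "p \<in> J"
    proof (cases "y \<le> p")
      case True
      then show ?thesis
        using \<eta> yp(2) by (intro that[of "{p - \<eta>..p}"]) auto
    next
      case False
      then show ?thesis
        using \<eta> yp(2) by (intro that[of "{p..p + \<eta>}"]) auto
    qed
    then obtain \<alpha> \<beta> where "4 < \<bar>\<alpha>\<bar>" "F y = \<alpha> * y + \<beta>" "F p = \<alpha> * p + \<beta>"
      unfolding steep_on_def by blast
    then show ?thesis
      using yp(1) by auto
  qed
  define n where "n = \<lfloor>p\<rfloor>"
  define d where "d = Min {\<eta>, p - a, b - p}"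
  have d: "0 < d" "d \<le> \<eta>" "d \<le> p - a" "d \<le> b - p"
    using \<eta>(1) p by (auto simp: d_def)
  have pn: "frac p + of_int n = p"
    by (simp add: n_def frac_def)
  have "F p < F (y + of_int n)" if "y \<noteq> frac p" "dist y (frac p) < d" for y
  proof -
    have "y + of_int n \<noteq> p" "\<bar>y + of_int n - p\<bar> < d"
      using that pn by (auto simp: dist_real_def)
    moreover from this have "y + of_int n \<in> {a..b}"
      using d unfolding atLeastAtMost_iff by linarith
    ultimately have "F (y + of_int n) \<noteq> F p" "F p \<le> F (y + of_int n)"
      using ne[of "y + of_int n"] min[of "y + of_int n"] d by auto
    then show ?thesis
      by simp
  qed
  then have "\<forall>\<^sub>F y in at (frac p). F (frac p + of_int n) < F (y + of_int n)"
    unfolding eventually_at pn using d(1) by blast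
  then show ?thesis
    unfolding critical_points_def using lifting_translate[OF F, of n] frac_lt_1[of p] by fastforce
qed

section \<open>Arcs whose images do not get longer\<close>

lemma measure_le_of_image_subset:
  assumes F: "lifting f F" and pres: "lebesgue_preserving f"
    and T: "T \<in> sets borel" "T \<subseteq> {t..<t + 1}"
    and S: "S \<in> sets borel" "S \<subseteq> {u..<u + 1}"
    and im: "F ` T \<subseteq> saturation S"
  shows "measure lebesgue T \<le> measure lebesgue S"
proof -
  let ?B = "saturation S"
  have "continuous_on UNIV F"
    using F by (simp add: lifting_def)
  then have FB: "F -` ?B \<in> sets borel"
    using borel_saturation[OF S(1)] by (rule borel_vimage_continuous)
  have "measure lebesgue T \<le> measure lebesgue (F -` ?B \<inter> {t..<t + 1})"
    using T im lmeasurable_bounded_borel(2)[OF FB] by (intro measure_mono_fmeasurable) auto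
  also have "\<dots> = measure lebesgue S"
    using lifting_preserves_measure[OF F pres borel_saturation[OF S(1)] periodic_saturation, of t 0]
      measure_saturation[OF S, of 0] by simp
  finally show ?thesis .
qed

lemma arc_width_nondecreasing:
  assumes F: "lifting f F" and pres: "lebesgue_preserving f"
    and ab: "a \<le> b" "b < a + 1" and im: "F ` {a..b} \<subseteq> {c..d}" and cd: "d < c + 1"
  shows "b - a \<le> d - c"
proof -
  have "c \<le> F a" "F a \<le> d"
    using im ab by (auto simp: image_subset_iff)
  have "measure lebesgue {a..b} \<le> measure lebesgue {c..d}"
    using ab cd im subset_saturation[of "{c..d}"]
    by (intro measure_le_of_image_subset[OF F pres, where t = a and u = c]) auto
  then show ?thesis
    using ab \<open>c \<le> F a\<close> \<open>F a \<le> d\<close> by simp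
qed

text \<open>
  Since the image \<open>[c,d]\<close> of \<open>[a,b]\<close> has the length of \<open>[a,b]\<close>, no open set outside \<open>[a,b]\<close>
  can be mapped into \<open>[c,d]\<close>. Hence the preimage of a short arc \<open>(c, c + \<delta>)\<close> stays inside
  \<open>[a,b]\<close>, near the points of height \<open>c\<close>: the two ends, and at most one interior point, because
  interior points of height \<open>c\<close> share their critical value. That leaves four branches.
\<close>

lemma non_expanding_arc_impossible:
  assumes F: "lifting f F" and pa: "piecewise_affine f" and pres: "lebesgue_preserving f"
    and dcv: "different_critical_values f" and sl: "slope_greater f 4"
    and ab: "a < b" "b < a + 1"
    and osc: "\<And>x y. x \<in> {a..b} \<Longrightarrow> y \<in> {a..b} \<Longrightarrow> F x - F y \<le> b - a"
  shows False
proof -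
  have cont: "continuous_on UNIV F"
    using F by (simp add: lifting_def)
  have fr: "frac (F x) = f (frac x)" for x
    using F by (simp add: lifting_def)
  obtain c d where cd: "F ` {a..b} = {c..d}" "c \<le> d"
    using continuous_image_closed_interval[of a b F] ab(1) continuous_on_subset[OF cont] by auto
  have range: "F x \<in> {c..d}" if "x \<in> {a..b}" for x
    using cd(1) that by blast
  obtain xc xd where x: "xc \<in> {a..b}" "F xc = c" "xd \<in> {a..b}" "F xd = d"
    using cd by (metis (no_types, lifting) atLeastAtMost_iff imageE order_refl)
  have width: "d - c \<le> b - a"
    using osc[OF x(3,1)] x by simp
  have "b - a \<le> d - c"
    using cd ab width by (intro arc_width_nondecreasing[OF F pres]) auto
  then have "c < d"
    using ab by simp
  \<comment> \<open>An open set outside the arc with values in \<open>(c, d)\<close> would make the preimage of the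
    image longer than the image.\<close>
  have outside: "F x \<notin> saturation {c<..<d}" if x: "x \<in> {b<..<a + 1}" for x
  proof
    assume "F x \<in> saturation {c<..<d}"
    then obtain k :: int where k: "F x + of_int k \<in> {c<..<d}"
      by (auto simp: saturation_def)
    define W where "W = (\<lambda>y. F y + of_int k) -` {c<..<d} \<inter> {b<..<a + 1}"
    have "open W"
      unfolding W_def using cont by (intro open_Int open_vimage continuous_intros) auto
    moreover have "x \<in> W"
      using x k by (simp add: W_def)
    ultimately obtain e where e: "0 < e" "cball x e \<subseteq> W"
      by (meson open_contains_cball)
    then have W: "{x..x + e} \<subseteq> W"
      by (auto simp: cball_eq_atLeastAtMost)
    have "x + e \<in> W"
      using W e(1) by auto
    then have T: "b < x" "x + e < a + 1" "{a..b} \<inter> {x..x + e} = {}"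
      using x by (auto simp: W_def)
    have "F y \<in> saturation {c..d}" if "y \<in> {a..b} \<union> {x..x + e}" for y
    proof (cases "y \<in> {a..b}")
      case True
      then show ?thesis
        using range subset_saturation by blast
    next
      case False
      then have "F y + of_int k \<in> {c..d}"
        using that W by (auto simp: W_def)
      then show ?thesis
        by (auto simp: saturation_def)
    qed
    then have "measure lebesgue ({a..b} \<union> {x..x + e}) \<le> measure lebesgue {c..d}"
      using T(1,2) ab width
      by (intro measure_le_of_image_subset[OF F pres, where t = a and u = c]) auto
    moreover have "measure lebesgue ({a..b} \<union> {x..x + e}) = (b - a) + e"
      using T(3) ab e(1) measure_Un3[of "{a..b}" lebesgue "{x..x + e}"] by simp
    ultimately show False
      using width e(1) \<open>c \<le> d\<close> by simp
  qed
  \<comment> \<open>Interior points of height \<open>c\<close> are critical with the common critical value \<open>frac c\<close>.\<close>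
  have crit: "frac q \<in> critical_points f" if "q \<in> {a<..<b}" "F q = c" for q
    using that range by (intro interior_minimum_is_critical[OF F pa sl, of a q b]) auto
  have uniq: "q = q'" if "q \<in> {a<..<b}" "F q = c" "q' \<in> {a<..<b}" "F q' = c" for q q'
  proof -
    have "f (frac q) = f (frac q')"
      using fr[of q] fr[of q'] that by simp
    then have "frac q = frac q'"
      using inj_onD[OF dcv[unfolded different_critical_values_def]] crit that by metis
    then show ?thesis
      using inj_onD[OF inj_on_frac_Icc[OF ab(2)], of q q'] that by auto
  qed
  \<comment> \<open>If no interior point has height \<open>c\<close>, any \<open>p\<close> serves, since the branches next to it
    do no harm to the covering.\<close>
  obtain p where p: "p \<in> {a<..<b}" "\<And>q. q \<in> {a<..<b} \<Longrightarrow> F q = c \<Longrightarrow> q = p"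
  proof (cases "\<exists>q\<in>{a<..<b}. F q = c")
    case True
    then show ?thesis
      using that uniq by blast
  next
    case False
    then show ?thesis
      using that[of "(a + b) / 2"] ab by auto
  qed
  obtain \<eta>a \<eta>b \<eta>p where \<eta>s: "0 < \<eta>a" "steep_on F {a..a + \<eta>a}" "0 < \<eta>b" "steep_on F {b - \<eta>b..b}"
    "0 < \<eta>p" "steep_on F {p - \<eta>p..p}" "steep_on F {p..p + \<eta>p}"
    using steep_near[OF F pa sl] by metis
  define \<eta> where "\<eta> = Min {\<eta>a, \<eta>b, \<eta>p}"
  have \<eta>: "0 < \<eta>" "\<eta> \<le> \<eta>a" "\<eta> \<le> \<eta>b" "\<eta> \<le> \<eta>p"
    using \<eta>s by (auto simp: \<eta>_def)
  define I where "I = {(a, a + \<eta>), (b - \<eta>, b), (p - \<eta>, p), (p, p + \<eta>)}"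
  have steep: "steep_on F {u..v}" if "(u, v) \<in> I" for u v
    using that \<eta> unfolding I_def
    by (auto intro: steep_on_subset[OF \<eta>s(2)] steep_on_subset[OF \<eta>s(4)]
        steep_on_subset[OF \<eta>s(6)] steep_on_subset[OF \<eta>s(7)])
  \<comment> \<open>Away from the four branches, \<open>F\<close> stays above \<open>c\<close> by a positive amount, by compactness.\<close>
  define R where "R = {a + \<eta>..b - \<eta>} - {p - \<eta><..<p + \<eta>}"
  have "compact R"
    unfolding R_def by (intro compact_diff) auto
  have R: "c < F x" if "x \<in> R" for x
  proof -
    have "x \<in> {a<..<b}" "x \<noteq> p"
      using that \<eta>(1) by (auto simp: R_def)
    then show ?thesis
      using p(2)[of x] range[of x] by fastforce
  qed
  obtain \<delta>0 where \<delta>0: "0 < \<delta>0" "\<And>x. x \<in> R \<Longrightarrow> c + \<delta>0 \<le> F x"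
  proof (cases "R = {}")
    case True
    then show ?thesis
      using that[of 1] by auto
  next
    case False
    then obtain m where "m \<in> R" "\<forall>x\<in>R. F m \<le> F x"
      using continuous_attains_inf[OF \<open>compact R\<close>] continuous_on_subset[OF cont] by blast
    then show ?thesis
      using that[of "F m - c"] R by auto
  qed
  define \<delta> where "\<delta> = min \<delta>0 (d - c)"
  have \<delta>: "0 < \<delta>" "\<delta> \<le> \<delta>0" "\<delta> \<le> d - c"
    using \<delta>0(1) \<open>c < d\<close> by (auto simp: \<delta>_def)
  let ?S = "{c<..<c + \<delta>}"
  have S: "?S \<subseteq> {c..<c + 1}"
    using \<delta>(3) width ab(2) by auto
  show False
  proof (rule four_branches_insufficient[OF F pres, where B = "saturation ?S" and I = I and t = a])
    show "0 < measure lebesgue (saturation ?S \<inter> {0..<1})"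
      using measure_saturation[OF _ S, of 0] \<delta>(1) by simp
    show "F -` saturation ?S \<inter> {a..<a + 1} \<subseteq> (\<Union>(u, v)\<in>I. {u..v})"
    proof
      fix x assume "x \<in> F -` saturation ?S \<inter> {a..<a + 1}"
      then have x: "F x \<in> saturation ?S" "a \<le> x" "x < a + 1"
        by auto
      have "saturation ?S \<subseteq> saturation {c<..<d}"
        using \<delta>(3) by (force simp: saturation_def)
      then have "x \<le> b"
        using outside[of x] x by force
      then have "F x \<in> saturation ?S \<inter> {c..<c + 1}"
        using x range[of x] width ab(2) by auto
      then have "F x \<in> ?S"
        by (simp only: saturation_Int_window[OF S])
      then have "x \<notin> R"
        using \<delta>0(2)[of x] \<delta>(2) by auto
      then show "x \<in> (\<Union>(u, v)\<in>I. {u..v})"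
        using \<open>a \<le> x\<close> \<open>x \<le> b\<close> \<eta>(1) unfolding R_def I_def by auto
    qed
  qed (use steep in \<open>auto simp: I_def borel_saturation periodic_saturation card_insert_if\<close>)
qed

text \<open>
  The gap \<open>(d, c + 1)\<close> that the image would leave can only be reached from the gap
  \<open>[b - 1, a)\<close> that the arc leaves, and the latter is so close to \<open>r\<close> that it carries at most two
  branches.
\<close>

lemma almost_full_arc_covers:
  assumes F: "lifting f F" and pres: "lebesgue_preserving f"
    and \<eta>: "steep_on F {r - \<eta>..r}" "steep_on F {r..r + \<eta>}"
    and ab: "r - \<eta> \<le> b - 1" "a \<le> r + \<eta>"
    and im: "F ` {a..b} \<subseteq> {c..d}" and cd: "c \<le> d"
  shows "c + 1 \<le> d"
proof (rule ccontr)
  assume "\<not> c + 1 \<le> d"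
  then have small: "d < c + 1"
    by simp
  let ?S = "{d<..<c + 1}" and ?I = "{(r - \<eta>, r), (r, r + \<eta>)}"
  have S: "?S \<subseteq> {d..<d + 1}"
    using cd by auto
  show False
  proof (rule four_branches_insufficient[OF F pres, where B = "saturation ?S" and I = ?I and t = "b - 1"])
    show "0 < measure lebesgue (saturation ?S \<inter> {0..<1})"
      using measure_saturation[OF _ S, of 0] small by simp
    show "F -` saturation ?S \<inter> {b - 1..<b - 1 + 1} \<subseteq> (\<Union>(u, v)\<in>?I. {u..v})"
    proof
      fix x assume "x \<in> F -` saturation ?S \<inter> {b - 1..<b - 1 + 1}"
      then have x: "F x \<in> saturation ?S" "b - 1 \<le> x" "x < b"
        by auto
      then obtain k :: int where k: "d < F x + of_int k" "F x + of_int k < c + 1"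
        by (auto simp: saturation_def)
      have "\<not> a \<le> x"
      proof
        assume "a \<le> x"
        then have "c \<le> F x" "F x \<le> d"
          using im x(3) by (auto simp: image_subset_iff)
        then have "0 < real_of_int k" "real_of_int k < 1"
          using k by linarith+
        then show False
          by simp
      qed
      then show "x \<in> (\<Union>(u, v)\<in>?I. {u..v})"
        using x ab by auto
    qed
  qed (use \<eta> in \<open>auto simp: borel_saturation periodic_saturation card_insert_if\<close>)
qed

section \<open>Growth of arcs\<close>

lemma funpow_frac_lifting:
  assumes "lifting f F"
  shows "(f ^^ n) (frac x) = frac ((F ^^ n) x)"
  using assms by (induction n) (auto simp: lifting_def)

text \<open>
  The widths increase to a limit \<open>L\<close>. A subsequence of the arcs, translated by integers,
  converges to \<open>[r, r + L]\<close>, on which \<open>F\<close> oscillates by at most \<open>L\<close>: for \<open>L < 1\<close> this arc is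
  impossible, and for \<open>L = 1\<close> already a late member of the sequence is.
\<close>

lemma iterated_arc_wraps:
  assumes F: "lifting f F" and pa: "piecewise_affine f" and pres: "lebesgue_preserving f"
    and dcv: "different_critical_values f" and sl: "slope_greater f 4"
    and init: "a 0 < b 0"
    and step: "\<And>n. F ` {a n..b n} = {a (Suc n)..b (Suc n)}"
  shows "\<exists>n. a n + 1 \<le> b n"
proof (rule ccontr)
  assume "\<not> ?thesis"
  then have short: "b n < a n + 1" for n
    by (simp add: not_le)
  have cont: "continuous_on UNIV F"
    using F by (simp add: lifting_def)
  have ab: "a n \<le> b n" for n
  proof (induction n)
    case (Suc n)
    then have "{a (Suc n)..b (Suc n)} \<noteq> {}"
      unfolding step[symmetric] by simp
    then show ?case
      by simp
  qed (use init in simp)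
  define w where "w n = b n - a n" for n
  have "w n \<le> w (Suc n)" for n
    unfolding w_def using ab short step by (intro arc_width_nondecreasing[OF F pres]) auto
  then have "incseq w"
    by (rule incseq_SucI)
  have w1: "w n < 1" for n
    using short[of n] by (simp add: w_def)
  obtain L where L: "w \<longlonglongrightarrow> L" "\<And>n. w n \<le> L"
    using incseq_convergent[OF \<open>incseq w\<close>, of 1] w1 less_imp_le by metis
  have "0 < L"
    using L(2)[of 0] init by (simp add: w_def)
  have "L \<le> 1"
    using L(1) w1 by (intro LIMSEQ_le_const2[of w L 1]) (auto intro: less_imp_le)
  \<comment> \<open>Translated by integers, the arcs start in \<open>[0,1)\<close>; the translation only shifts images.\<close>
  define s where "s n = frac (a n)" for n
  have trans: "\<exists>k::int. F ` {s n..s n + w n} = {a (Suc n) + of_int k..b (Suc n) + of_int k}" for n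
  proof -
    define m where "m = - \<lfloor>a n\<rfloor>"
    have s: "s n = a n + of_int m" "s n + w n = b n + of_int m"
      by (auto simp: s_def w_def m_def frac_def)
    obtain k :: int where k: "\<And>x. F (x + of_int m) = F x + of_int k"
      using lifting_integer_shift[OF F] by blast
    have "{s n..s n + w n} = (\<lambda>x. x + of_int m) ` {a n..b n}"
      unfolding s(2) unfolding s(1) by simp
    then have "F ` {s n..s n + w n} = F ` ((\<lambda>x. x + of_int m) ` {a n..b n})"
      by (rule arg_cong)
    also have "\<dots> = (\<lambda>y. y + of_int k) ` (F ` {a n..b n})"
      by (simp only: image_image k)
    also have "\<dots> = {a (Suc n) + of_int k..b (Suc n) + of_int k}"
      by (simp add: step)
    finally show ?thesis
      by blast
  qed
  have osc: "F x - F y \<le> L" if "x \<in> {s n..s n + w n}" "y \<in> {s n..s n + w n}" for x y n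
  proof -
    obtain k :: int where "F ` {s n..s n + w n} = {a (Suc n) + of_int k..b (Suc n) + of_int k}"
      using trans by blast
    then have "F x \<le> b (Suc n) + of_int k" "a (Suc n) + of_int k \<le> F y"
      using that by (metis atLeastAtMost_iff imageI)+
    then show ?thesis
      using L(2)[of "Suc n"] by (simp add: w_def)
  qed
  have "\<forall>n. s n \<in> {0..1}"
    by (auto simp: s_def frac_lt_1 less_imp_le)
  then obtain r \<phi> where \<phi>: "strict_mono (\<phi> :: nat \<Rightarrow> nat)" and r: "(s \<circ> \<phi>) \<longlonglongrightarrow> r"
    using compact_Icc[of 0 "1::real"] unfolding compact_def by metis
  have wL: "(w \<circ> \<phi>) \<longlonglongrightarrow> L"
    using LIMSEQ_subseq_LIMSEQ[OF L(1) \<phi>] .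
  show False
  proof (cases "L < 1")
    case True
    \<comment> \<open>A point of the limit arc is the limit of the points of the approximating arcs that
      divide them in the same ratio \<open>\<theta>\<close>.\<close>
    have lim: "(\<lambda>n. F (s (\<phi> n) + \<theta> * w (\<phi> n))) \<longlonglongrightarrow> F (r + \<theta> * L)" for \<theta>
      using r wL cont by (intro continuous_on_tendsto_compose[OF cont] tendsto_intros) (auto simp: o_def)
    have "F x - F y \<le> r + L - r" if xy: "x \<in> {r..r + L}" "y \<in> {r..r + L}" for x y
    proof -
      define \<theta> where "\<theta> z = (z - r) / L" for z
      have \<theta>: "0 \<le> \<theta> z" "\<theta> z \<le> 1" "r + \<theta> z * L = z" if "z \<in> {r..r + L}" for z
        using that \<open>0 < L\<close> by (auto simp: \<theta>_def field_simps)
      have mem: "s (\<phi> n) + \<theta> z * w (\<phi> n) \<in> {s (\<phi> n)..s (\<phi> n) + w (\<phi> n)}"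
        if "z \<in> {r..r + L}" for z n
        using \<theta>[OF that] ab[of "\<phi> n"] mult_left_le_one_le[of "w (\<phi> n)" "\<theta> z"]
        by (simp add: w_def)
      have "F (r + \<theta> x * L) - F (r + \<theta> y * L) \<le> L"
        using osc[OF mem[OF xy(1)] mem[OF xy(2)]]
        by (intro LIMSEQ_le_const2[OF tendsto_diff[OF lim[of "\<theta> x"] lim[of "\<theta> y"]]]) blast
      then show ?thesis
        using \<theta>(3) xy by simp
    qed
    then show False
      using \<open>0 < L\<close> True by (intro non_expanding_arc_impossible[OF F pa pres dcv sl, of r "r + L"]) auto
  next
    case False
    with \<open>L \<le> 1\<close> have "L = 1"
      by simp
    obtain \<eta> where \<eta>: "0 < \<eta>" "steep_on F {r - \<eta>..r}" "steep_on F {r..r + \<eta>}"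
      using steep_near[OF F pa sl] by blast
    have "(\<lambda>n. s (\<phi> n) + w (\<phi> n)) \<longlonglongrightarrow> r + 1"
      using tendsto_add[OF r wL] \<open>L = 1\<close> by (simp add: o_def)
    then have "\<forall>\<^sub>F n in sequentially. r + 1 - \<eta> < s (\<phi> n) + w (\<phi> n)"
      using \<eta>(1) by (intro order_tendstoD(1)) auto
    moreover have "\<forall>\<^sub>F n in sequentially. s (\<phi> n) < r + \<eta>"
      using r \<eta>(1) by (intro order_tendstoD(2)[of _ r]) (auto simp: o_def)
    ultimately have "\<forall>\<^sub>F n in sequentially. r + 1 - \<eta> < s (\<phi> n) + w (\<phi> n) \<and> s (\<phi> n) < r + \<eta>"
      by (rule eventually_conj)
    then obtain n where n: "r + 1 - \<eta> < s (\<phi> n) + w (\<phi> n)" "s (\<phi> n) < r + \<eta>"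
      using eventually_happens'[OF sequentially_bot] by blast
    obtain k :: int where k: "F ` {s (\<phi> n)..s (\<phi> n) + w (\<phi> n)}
        = {a (Suc (\<phi> n)) + of_int k..b (Suc (\<phi> n)) + of_int k}"
      using trans by blast
    have "a (Suc (\<phi> n)) + of_int k + 1 \<le> b (Suc (\<phi> n)) + of_int k"
      using n k ab[of "Suc (\<phi> n)"]
      by (intro almost_full_arc_covers[OF F pres \<eta>(2,3), of "s (\<phi> n) + w (\<phi> n)" "s (\<phi> n)"]) auto
    then show False
      using short[of "Suc (\<phi> n)"] by simp
  qed
qed

theorem corollary5:
  fixes f :: "real \<Rightarrow> real"
  assumes "continuous_map circle circle f"
    and "piecewise_affine f"
    and "lebesgue_preserving f"
    and "different_critical_values f"
    and "slope_greater f 4"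
  shows "leo f"
  unfolding leo_def
proof (intro allI impI)
  fix U assume U: "openin circle U \<and> U \<noteq> {}"
  obtain F where F: "lifting f F"
    using assms(2) unfolding piecewise_affine_def by blast
  then have cont: "continuous_on UNIV F"
    by (simp add: lifting_def)
  have U01: "U \<subseteq> {0..<1}" and "open (frac -` U :: real set)"
    using U by (auto simp: openin_circle)
  obtain x0 where "x0 \<in> U"
    using U by blast
  then have "x0 \<in> frac -` U"
    using U01 by (metis frac_eq_id subsetD vimageI2)
  then obtain e where e: "0 < e" "cball x0 e \<subseteq> frac -` U"
    using \<open>open (frac -` U)\<close> by (meson open_contains_cball)
  define A where "A n = (F ^^ n) ` {x0 - e..x0 + e}" for n
  have "\<exists>c d. c \<le> d \<and> A n = {c..d}" for n
  proof (induction n)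
    case 0
    then show ?case
      using e(1) by (intro exI[of _ "x0 - e"] exI[of _ "x0 + e"]) (auto simp: A_def)
  next
    case (Suc n)
    then obtain c d where "c \<le> d" "A n = {c..d}"
      by blast
    moreover have "A (Suc n) = F ` A n"
      by (simp add: A_def image_image)
    ultimately show ?case
      using continuous_image_closed_interval[of c d F] continuous_on_subset[OF cont] by auto
  qed
  then obtain a b where ab: "\<And>n. a n \<le> b n" "\<And>n. A n = {a n..b n}"
    by metis
  have "F ` {a n..b n} = {a (Suc n)..b (Suc n)}" for n
    unfolding ab(2)[symmetric] by (simp add: A_def image_image)
  moreover have "a 0 < b 0"
  proof -
    have "x0 \<in> {a 0..b 0}" "x0 + e \<in> {a 0..b 0}"
      using e(1) unfolding ab(2)[symmetric] by (auto simp: A_def)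
    then show ?thesis
      using e(1) by auto
  qed
  ultimately obtain n where n: "a n + 1 \<le> b n"
    using iterated_arc_wraps[OF F assms(2-5)] by blast
  have "{0..<1} \<subseteq> (f ^^ n) ` U"
  proof
    fix y :: real assume "y \<in> {0..<1}"
    then obtain z where z: "z \<in> {a n..<a n + 1}" "frac z = y"
      using bij_betw_imp_surj_on[OF bij_betw_frac[of "a n"]] by (metis imageE)
    then have "z \<in> A n"
      using n ab(2) by auto
    then obtain x where x: "x \<in> {x0 - e..x0 + e}" "z = (F ^^ n) x"
      by (auto simp: A_def)
    have "frac x \<in> U"
      using e(2) x(1) by (auto simp: cball_eq_atLeastAtMost)
    moreover have "(f ^^ n) (frac x) = y"
      using funpow_frac_lifting[OF F] x(2) z(2) by simp
    ultimately show "y \<in> (f ^^ n) ` U"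
      by blast
  qed
  moreover have "(f ^^ n) u \<in> {0..<1}" if "u \<in> U" for u
    using funpow_frac_lifting[OF F, of n u] frac_eq_id[of u] U01 that frac_lt_1 frac_ge_0
    by (metis atLeastLessThan_iff subsetD)
  ultimately show "\<exists>n. (f ^^ n) ` U = {0..<1}"
    by (intro exI[of _ n]) auto
qed

end
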